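(* There exists a subset $A\subset\mathbb{R}$ such that $(\mathbb{R},\tau_A)$ is not quasi-metrizable.
   Context: For $A\subset\mathbb{R}$, $\tau_A$ is the topology on $\mathbb{R}$ in which each $x\in A$ has neighborhood base $\{(x-\varepsilon,x+\varepsilon):\varepsilon>0\}$ and each $x\in\mathbb{R}\setminus A$ has neighborhood base $\{[x,x+\varepsilon):\varepsilon>0\}$. A space $X$ is quasi-metrizable if there is a function $d:X\times X\to[0,\infty)$ with $d(x,y)=0$ iff $x=y$ and $d(x,z)\le d(x,y)+d(y,z)$ for all $x,y,z$ (symmetry is not required), such that for each $x\in X$ the sets $\{y\in X: d(x,y)<\varepsilon\}$, $\varepsilon>0$, form a neighborhood base at $x$. *)

theory Defs
  imports "HOL-Analysis.Analysis"
begin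

definition nhd_base_at :: "'a topology \<Rightarrow> 'a \<Rightarrow> 'a set set \<Rightarrow> bool" where
  "nhd_base_at X x \<B> \<longleftrightarrow>
     (\<forall>V\<in>\<B>. V \<subseteq> topspace X \<and> x \<in> X interior_of V) \<and>
     (\<forall>W. openin X W \<and> x \<in> W \<longrightarrow> (\<exists>V\<in>\<B>. V \<subseteq> W))"

definition quasi_metric_on :: "'a set \<Rightarrow> ('a \<Rightarrow> 'a \<Rightarrow> real) \<Rightarrow> bool" where
  "quasi_metric_on S d \<longleftrightarrow>
     (\<forall>x\<in>S. \<forall>y\<in>S. 0 \<le> d x y) \<and>
     (\<forall>x\<in>S. \<forall>y\<in>S. d x y = 0 \<longleftrightarrow> x = y) \<and>
     (\<forall>x\<in>S. \<forall>y\<in>S. \<forall>z\<in>S. d x z \<le> d x y + d y z)"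

definition quasi_metrizable_space :: "'a topology \<Rightarrow> bool" where
  "quasi_metrizable_space X \<longleftrightarrow>
     (\<exists>d. quasi_metric_on (topspace X) d \<and>
       (\<forall>x\<in>topspace X.
          nhd_base_at X x {{y \<in> topspace X. d x y < \<epsilon>} | \<epsilon>. 0 < \<epsilon>}))"

definition basic_nhd :: "real set \<Rightarrow> real \<Rightarrow> real \<Rightarrow> real set" where
  "basic_nhd A x \<epsilon> = (if x \<in> A then {x - \<epsilon><..<x + \<epsilon>} else {x..<x + \<epsilon>})"

definition tau :: "real set \<Rightarrow> real topology" where
  "tau A = topology (\<lambda>U. \<forall>x\<in>U. \<exists>\<epsilon>>0. basic_nhd A x \<epsilon> \<subseteq> U)"

lemma basic_nhd_mono: "\<epsilon> \<le> \<delta> \<Longrightarrow> basic_nhd A x \<epsilon> \<subseteq> basic_nhd A x \<delta>"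
  by (auto simp: basic_nhd_def)

lemma openin_tau: "openin (tau A) U \<longleftrightarrow> (\<forall>x\<in>U. \<exists>\<epsilon>>0. basic_nhd A x \<epsilon> \<subseteq> U)"
proof -
  have "istopology (\<lambda>U. \<forall>x\<in>U. \<exists>\<epsilon>>0. basic_nhd A x \<epsilon> \<subseteq> U)"
    unfolding istopology_def
  proof (intro conjI allI impI ballI)
    fix S T x
    assume S: "\<forall>x\<in>S. \<exists>\<epsilon>>0. basic_nhd A x \<epsilon> \<subseteq> S"
      and T: "\<forall>x\<in>T. \<exists>\<epsilon>>0. basic_nhd A x \<epsilon> \<subseteq> T" and x: "x \<in> S \<inter> T"
    obtain e where e: "e > 0" "basic_nhd A x e \<subseteq> S" using S x by blast
    obtain f where f: "f > 0" "basic_nhd A x f \<subseteq> T" using T x by blast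
    have "basic_nhd A x (min e f) \<subseteq> S \<inter> T"
      using e(2) f(2) basic_nhd_mono[of "min e f" e A x] basic_nhd_mono[of "min e f" f A x] by auto
    then show "\<exists>\<epsilon>>0. basic_nhd A x \<epsilon> \<subseteq> S \<inter> T"
      using e(1) f(1) by (intro exI[of _ "min e f"]) auto
  next
    fix K x
    assume K: "\<forall>S\<in>K. \<forall>x\<in>S. \<exists>\<epsilon>>0. basic_nhd A x \<epsilon> \<subseteq> S" and "x \<in> \<Union>K"
    then obtain S where "S \<in> K" "x \<in> S" by blast
    then show "\<exists>\<epsilon>>0. basic_nhd A x \<epsilon> \<subseteq> \<Union>K"
      using K by (meson Union_upper subset_trans)
  qed
  then show ?thesis by (simp add: tau_def topology_inverse')
qed

lemma topspace_tau [simp]: "topspace (tau A) = UNIV"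
proof -
  have "openin (tau A) UNIV" unfolding openin_tau using zero_less_one by blast
  then show ?thesis using openin_subset by blast
qed

lemma openin_basic_nhd: "openin (tau A) (basic_nhd A x \<epsilon>)"
  unfolding openin_tau
proof
  fix y assume y: "y \<in> basic_nhd A x \<epsilon>"
  define \<delta> where "\<delta> = (if y = x then \<epsilon> else min (\<bar>y - x\<bar>) (\<epsilon> - \<bar>y - x\<bar>))"
  have "\<delta> > 0" "basic_nhd A y \<delta> \<subseteq> basic_nhd A x \<epsilon>"
    using y by (auto simp: basic_nhd_def \<delta>_def abs_if split: if_splits)
  then show "\<exists>\<delta>>0. basic_nhd A y \<delta> \<subseteq> basic_nhd A x \<epsilon>" by blast
qed

text \<open>The topology \<open>tau A\<close> is the one, and the only one, with the prescribed
  neighbourhood bases.\<close>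

lemma nhd_base_at_tau: "nhd_base_at (tau A) x {basic_nhd A x \<epsilon> | \<epsilon>. 0 < \<epsilon>}"
proof -
  have "x \<in> basic_nhd A x \<epsilon>" if "\<epsilon> > 0" for \<epsilon>
    using that by (simp add: basic_nhd_def)
  moreover have "\<exists>V\<in>{basic_nhd A x \<epsilon> | \<epsilon>. 0 < \<epsilon>}. V \<subseteq> W" if "openin (tau A) W" "x \<in> W" for W
    using that unfolding openin_tau by blast
  moreover have "tau A interior_of basic_nhd A x \<epsilon> = basic_nhd A x \<epsilon>" for \<epsilon>
    by (simp add: interior_of_openin openin_basic_nhd)
  ultimately show ?thesis
    unfolding nhd_base_at_def by auto
qed

lemma tau_unique:
  assumes "topspace X = UNIV"
    and "\<And>x. nhd_base_at X x {basic_nhd A x \<epsilon> | \<epsilon>. 0 < \<epsilon>}"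
  shows "X = tau A"
  unfolding topology_eq
proof (intro allI iffI)
  fix U assume "openin X U"
  then show "openin (tau A) U"
    using assms(2) unfolding openin_tau nhd_base_at_def by blast
next
  fix U assume U: "openin (tau A) U"
  have "x \<in> X interior_of U" if "x \<in> U" for x
  proof -
    obtain \<epsilon> where "\<epsilon> > 0" "basic_nhd A x \<epsilon> \<subseteq> U" using U \<open>x \<in> U\<close> unfolding openin_tau by blast
    then show ?thesis
      using assms(2)[of x] interior_of_mono[of "basic_nhd A x \<epsilon>" U X]
      unfolding nhd_base_at_def by blast
  qed
  then have "X interior_of U = U" by (simp add: subset_antisym interior_of_subset subsetI)
  then show "openin X U" by (metis openin_interior_of)
qed

end

(*  Take A countable and dense, and let d be a quasi-metric for tau A. Each y outside A lies in some
    B(n,k): every z with d y z < 2/(n+1) satisfies y \<le> z, and [y, y + 1/(k+1)) is contained in the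
    d-ball of radius 1/(n+1) about y. By Baire, some B(n,k) is dense near a point a of A. The d-ball of
    radius 1/(n+1) about a contains some z < a; choosing y in B(n,k) with z < y < a close to a gives
    d y z \<le> d y a + d a z < 2/(n+1), contradicting z < y. *)

theory Submission
  imports Defs
begin

text \<open>Otherwise the complements of the sets \<open>closure (B i)\<close> and of the points of
  \<open>A\<close> are countably many dense open sets, so by Baire they share a point;
  \<open>cover\<close> forbids this. Complements of points are dense because a Euclidean space has
  positive dimension.\<close>

lemma Baire_somewhere_dense:
  fixes A :: "'a::euclidean_space set" and B :: "'i::countable \<Rightarrow> 'a set"
  assumes "countable A" and cover: "- A \<subseteq> (\<Union>i. B i)"
  obtains i where "interior (closure (B i)) \<noteq> {}"
proof -
  have False if empty: "\<And>i. interior (closure (B i)) = {}"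
  proof -
    let ?\<G> = "range (\<lambda>i. - closure (B i)) \<union> (\<lambda>a. - {a}) ` A"
    have "UNIV \<subseteq> closure (\<Inter>?\<G>)"
    proof (rule Baire)
      show "countable ?\<G>"
        using \<open>countable A\<close> by blast
      show "openin (top_of_set UNIV) T \<and> UNIV \<subseteq> closure T" if "T \<in> ?\<G>" for T
        using that empty by (auto simp: closure_complement)
    qed simp
    moreover have "\<Inter>?\<G> = {}"
    proof -
      have "x \<notin> \<Inter>?\<G>" for x
      proof (cases "x \<in> A")
        case False
        then obtain i where "x \<in> closure (B i)"
          using cover closure_subset by (metis ComplI UN_E subsetD)
        then show ?thesis by blast
      qed blast
      then show ?thesis by blast
    qed
    ultimately show False
      by (metis closure_empty UNIV_not_empty subset_empty)
  qed
  then show ?thesis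
    using that by blast
qed

lemma quasi_metric_ball_contains_basic_nhd:
  fixes d :: "real \<Rightarrow> real \<Rightarrow> real"
  assumes "nhd_base_at (tau A) x {{y. d x y < \<epsilon>} | \<epsilon>. 0 < \<epsilon>}" and "e > 0"
  obtains r where "r > 0" "\<And>y. y \<in> basic_nhd A x r \<Longrightarrow> d x y < e"
proof -
  have "\<forall>V\<in>{{y. d x y < \<epsilon>} | \<epsilon>. 0 < \<epsilon>}. x \<in> tau A interior_of V"
    using assms(1) unfolding nhd_base_at_def by simp
  with \<open>e > 0\<close> have "x \<in> tau A interior_of {y. d x y < e}"
    by blast
  then obtain T where T: "openin (tau A) T" "x \<in> T" "T \<subseteq> {y. d x y < e}"
    unfolding interior_of_def by blast
  then obtain r where "r > 0" "basic_nhd A x r \<subseteq> T"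
    unfolding openin_tau by blast
  with T show thesis
    by (intro that) auto
qed

text \<open>Off \<open>A\<close> the half-open interval \<open>basic_nhd A x 1\<close> is an open
  neighbourhood of \<open>x\<close>, so it contains a whole ball about \<open>x\<close>.\<close>

lemma quasi_metric_ball_right_of_center:
  fixes d :: "real \<Rightarrow> real \<Rightarrow> real"
  assumes "nhd_base_at (tau A) x {{y. d x y < \<epsilon>} | \<epsilon>. 0 < \<epsilon>}" and "x \<notin> A"
  obtains e where "e > 0" "\<And>y. d x y < e \<Longrightarrow> x \<le> y"
proof -
  have "x \<in> basic_nhd A x 1"
    by (simp add: basic_nhd_def)
  then have "\<exists>V\<in>{{y. d x y < \<epsilon>} | \<epsilon>. 0 < \<epsilon>}. V \<subseteq> basic_nhd A x 1"
    using assms(1) openin_basic_nhd[of A x 1] unfolding nhd_base_at_def by simp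
  then obtain e where "e > 0" "{y. d x y < e} \<subseteq> basic_nhd A x 1"
    by blast
  with \<open>x \<notin> A\<close> show thesis
    by (intro that[of e]) (auto simp: basic_nhd_def)
qed

theorem not_quasi_metrizable_tau_countable_dense:
  assumes "countable A" and dense: "closure A = UNIV"
  shows "\<not> quasi_metrizable_space (tau A)"
proof
  assume "quasi_metrizable_space (tau A)"
  then obtain d :: "real \<Rightarrow> real \<Rightarrow> real" where triangle: "\<And>x y z. d x z \<le> d x y + d y z"
    and base: "\<And>x. nhd_base_at (tau A) x {{y. d x y < \<epsilon>} | \<epsilon>. 0 < \<epsilon>}"
    unfolding quasi_metrizable_space_def quasi_metric_on_def topspace_tau
    by (simp only: UNIV_I simp_thms ball_UNIV) blast
  \<comment> \<open>The bound \<open>2 / Suc n\<close> leaves room for two distances below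
    \<open>1 / Suc n\<close>, from \<open>y\<close> to \<open>a\<close> and from \<open>a\<close> to
    \<open>z\<close>. The index \<open>k\<close> makes the length of the right interval uniform over
    the set.\<close>
  define B where "B = (\<lambda>(n::nat, k::nat). {y. (\<forall>z. d y z < 2 / Suc n \<longrightarrow> y \<le> z) \<and>
                         (\<forall>z. y \<le> z \<and> z < y + 1 / Suc k \<longrightarrow> d y z < 1 / Suc n)})"
  have "- A \<subseteq> (\<Union>i. B i)"
  proof
    fix y assume "y \<in> - A"
    then have "y \<notin> A" by simp
    then obtain e where "e > 0" and e: "\<And>z. d y z < e \<Longrightarrow> y \<le> z"
      using quasi_metric_ball_right_of_center[of A y d] base by metis
    obtain n where n: "1 / Suc n < e / 2"
      using nat_approx_posE[of "e / 2"] \<open>e > 0\<close> by auto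
    obtain r where "r > 0" and r: "\<And>z. z \<in> basic_nhd A y r \<Longrightarrow> d y z < 1 / Suc n"
      using quasi_metric_ball_contains_basic_nhd[of A y d "1 / Suc n"] base
      by (metis of_nat_0_less_iff zero_less_Suc zero_less_divide_1_iff)
    obtain k where k: "1 / Suc k < r"
      using nat_approx_posE[OF \<open>r > 0\<close>] by auto
    have "2 / Suc n < e"
      using n by simp
    moreover have "d y z < 1 / Suc n" if "y \<le> z" "z < y + 1 / Suc k" for z
      using that k \<open>y \<notin> A\<close> by (intro r) (simp add: basic_nhd_def)
    ultimately have "y \<in> B (n, k)"
      using e by (simp add: B_def)
    then show "y \<in> (\<Union>i. B i)" by blast
  qed
  then obtain n k where somewhere_dense: "interior (closure (B (n, k))) \<noteq> {}"
    using Baire_somewhere_dense[OF \<open>countable A\<close>] by (metis surj_pair)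
  let ?U = "interior (closure (B (n, k)))"
  obtain a where "a \<in> A" "a \<in> ?U"
    using somewhere_dense dense open_Int_closure_eq_empty[of ?U A] by auto
  obtain r where "r > 0" and r: "\<And>z. z \<in> basic_nhd A a r \<Longrightarrow> d a z < 1 / Suc n"
    using quasi_metric_ball_contains_basic_nhd[of A a d "1 / Suc n"] base
    by (metis of_nat_0_less_iff zero_less_Suc zero_less_divide_1_iff)
  \<comment> \<open>Since \<open>a \<in> A\<close>, the basic neighbourhood of \<open>a\<close> is
    two-sided, so its ball reaches points to the left of \<open>a\<close>.\<close>
  define z where "z = a - r / 2"
  have "z < a" and daz: "d a z < 1 / Suc n"
    using \<open>r > 0\<close> \<open>a \<in> A\<close> r by (simp_all add: z_def basic_nhd_def)
  obtain e where "e > 0" and e: "ball a e \<subseteq> ?U"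
    using \<open>a \<in> ?U\<close> open_contains_ball open_interior by blast
  \<comment> \<open>For \<open>y\<close> between \<open>l\<close> and \<open>a\<close>, the three
    entries give in turn \<open>z < y\<close>, that \<open>a\<close> lies in the right interval of
    \<open>y\<close>, and that \<open>y\<close> stays where \<open>B (n, k)\<close> is
    dense.\<close>
  define l where "l = Max {z, a - 1 / Suc k, a - e}"
  have "l < a"
    using \<open>z < a\<close> \<open>e > 0\<close> by (simp add: l_def)
  have "{l<..<a} \<subseteq> ball a e"
    unfolding l_def by (auto simp: dist_real_def)
  then have "{l<..<a} \<subseteq> closure (B (n, k))"
    using e interior_subset by blast
  \<comment> \<open>An open set missing \<open>B (n, k)\<close> also misses its closure, whereas
    this nonempty interval lies inside the closure.\<close>
  then have "{l<..<a} \<inter> B (n, k) \<noteq> {}"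
    using \<open>l < a\<close> open_Int_closure_eq_empty[of "{l<..<a}" "B (n, k)"]
    by (simp add: Int_absorb2)
  then obtain y where "y \<in> B (n, k)" "l < y" "y < a"
    by auto
  then have y: "y \<in> B (n, k)" "z < y" "y < a" "a < y + 1 / Suc k"
    by (simp_all add: l_def)
  then have "d y a < 1 / Suc n"
    by (simp add: B_def)
  with daz have "d y a + d a z < 2 / Suc n"
    by simp
  with triangle[of y z a] have "d y z < 2 / Suc n"
    by linarith
  with y(1) have "y \<le> z"
    by (simp add: B_def)
  with y(2) show False by simp
qed

theorem mainTheorem6: "\<exists>A :: real set. \<not> quasi_metrizable_space (tau A)"
  using not_quasi_metrizable_tau_countable_dense[OF countable_rat Rats_closure_real] by blast

end
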